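(* Let $\pi$ be any permutation in $S_n$ and let $\mu=(\mu_1,\dots,\mu_k)$ be any partition of $m$ with $k$ (positive) parts. If $(\mu_1^k)\subseteq \mathrm{shape}(\pi)$, where $(\mu_1^k)=(\mu_1,\dots,\mu_1)$ with $k$ parts, then $\mu$ is the shape of some subsequence of $\pi$.
   Context: The Robinson-Schensted(-Knuth) correspondence (by row insertion) associates to a permutation $\pi=(\pi_1,\dots,\pi_n)\in S_n$, written as a word, or more generally to a finite sequence of distinct integers, a pair of tableaux of the same shape; this common shape, a partition of the length of the sequence, is called the shape of the permutation (or sequence), denoted $\mathrm{shape}(\pi)$. A subsequence of $\pi$ is a sequence $(\pi_{i_1},\dots,\pi_{i_r})$ with $i_1<\dots<i_r$, and its shape is its shape as a sequence of distinct integers. For partitions $\mu=(\mu_1,\mu_2,\dots)$ and $\lambda=(\lambda_1,\lambda_2,\dots)$ (padded by zeros, not necessarily of the same number), $\mu\subseteq\lambda$ means $\mu_i\le\lambda_i$ for all $i$. *)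

theory Defs
  imports "HOL-Library.Sublist" "HOL-Combinatorics.Permutations"
begin

text \<open>A tableau is the list of its rows, top row first, without empty rows.\<close>

type_synonym 'a tableau = "'a list list"

definition tableau_shape :: "'a tableau \<Rightarrow> nat list" where
  "tableau_shape T = map length T"

text \<open>\<open>row_bump x r\<close> lets \<open>x\<close> replace the leftmost entry of \<open>r\<close> exceeding it, and also returns
  that entry; if there is none, \<open>x\<close> goes to the end of the row.\<close>

fun row_bump :: "'a::linorder \<Rightarrow> 'a list \<Rightarrow> 'a option \<times> 'a list" where
  "row_bump x [] = (None, [x])"
| "row_bump x (y # ys) =
     (if x < y then (Some y, x # ys)
      else (case row_bump x ys of (b, r) \<Rightarrow> (b, y # r)))"

fun row_insert :: "'a::linorder \<Rightarrow> 'a tableau \<Rightarrow> 'a tableau" where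
  "row_insert x [] = [[x]]"
| "row_insert x (r # T) =
     (case row_bump x r of
        (None, r') \<Rightarrow> r' # T
      | (Some y, r') \<Rightarrow> r' # row_insert y T)"

text \<open>\<open>record_box t s Q\<close> appends \<open>t\<close> to the first row of \<open>Q\<close> that is shorter than the
  corresponding entry of \<open>s\<close>.  It is used when \<open>s\<close> exceeds the shape of \<open>Q\<close> by one box.\<close>

fun record_box :: "nat \<Rightarrow> nat list \<Rightarrow> nat tableau \<Rightarrow> nat tableau" where
  "record_box t [] Q = Q"
| "record_box t (l # s) [] = [[t]]"
| "record_box t (l # s) (q # Q) =
     (if length q < l then (q @ [t]) # Q else q # record_box t s Q)"

definition rs_step ::
  "nat \<times> 'a::linorder \<Rightarrow> 'a tableau \<times> nat tableau \<Rightarrow> 'a tableau \<times> nat tableau" where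
  "rs_step tx PQ =
     (let P' = row_insert (snd tx) (fst PQ)
      in (P', record_box (fst tx) (tableau_shape P') (snd PQ)))"

definition robinson_schensted :: "'a::linorder list \<Rightarrow> 'a tableau \<times> nat tableau" where
  "robinson_schensted w = fold rs_step (List.enumerate 1 w) ([], [])"

definition shape :: "'a::linorder list \<Rightarrow> nat list" where
  "shape w = tableau_shape (fst (robinson_schensted w))"

lemma row_bump_length:
  "length (snd (row_bump x r)) = (if fst (row_bump x r) = None then Suc (length r) else length r)"
  by (induction r) (auto split: prod.splits)

lemma record_box_shape:
  "map length P = map length Q \<Longrightarrow>
   map length (record_box t (map length (row_insert x P)) Q) = map length (row_insert x P)"
proof (induction P arbitrary: x Q)
  case Nil
  then show ?case by simp
next
  case (Cons p P)
  then obtain q Q' where Q: "Q = q # Q'" "length q = length p" "map length P = map length Q'"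
    by (cases Q) auto
  obtain b r where b: "row_bump x p = (b, r)" by fastforce
  show ?case using row_bump_length[of x p] Cons.IH[OF Q(3)] Q b
    by (cases b) auto
qed

text \<open>The two tableaux have the same shape.\<close>

lemma robinson_schensted_same_shape:
  "tableau_shape (snd (robinson_schensted w)) = shape w"
proof -
  have "map length (fst (fold rs_step xs PQ)) = map length (snd (fold rs_step xs PQ))"
    if "map length (fst PQ) = map length (snd PQ)"
    for xs and PQ :: "'a tableau \<times> nat tableau"
    using that
    by (induction xs arbitrary: PQ)
      (simp_all add: rs_step_def Let_def tableau_shape_def record_box_shape)
  then show ?thesis
    by (simp add: shape_def robinson_schensted_def tableau_shape_def)
qed

lemma fst_robinson_schensted: "fst (robinson_schensted w) = fold row_insert w []"
proof -
  have "fst (fold rs_step (List.enumerate k w) PQ) = fold row_insert w (fst PQ)"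
    for k and PQ :: "'a tableau \<times> nat tableau"
    by (induction w arbitrary: k PQ) (simp_all add: rs_step_def Let_def)
  then show ?thesis by (simp add: robinson_schensted_def)
qed

text \<open>A permutation of \<open>{1..n}\<close> in one-line notation.\<close>

definition one_line :: "nat \<Rightarrow> (nat \<Rightarrow> nat) \<Rightarrow> nat list" where
  "one_line n p = map p [1..<Suc n]"

definition partition_of :: "nat list \<Rightarrow> nat \<Rightarrow> bool" where
  "partition_of \<mu> m \<longleftrightarrow> sorted_wrt (\<ge>) \<mu> \<and> (\<forall>i\<in>set \<mu>. 0 < i) \<and> sum_list \<mu> = m"

definition part :: "nat list \<Rightarrow> nat \<Rightarrow> nat" where
  "part \<mu> i = (if i < length \<mu> then \<mu> ! i else 0)"

definition diagram_le :: "nat list \<Rightarrow> nat list \<Rightarrow> bool" where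
  "diagram_le \<mu> \<nu> \<longleftrightarrow> (\<forall>i. part \<mu> i \<le> part \<nu> i)"

end

theory Submission
  imports Defs
begin

text \<open>Let \<open>\<lambda>\<close> be the shape of \<open>w\<close>, let the rectangle with \<open>k\<close> rows and \<open>a\<close> columns fit into \<open>\<lambda>\<close>,
  and enlarge it along the diagonal to the last rectangle \<open>K \<times> L\<close> that fits.  Then the first \<open>K\<close>
  rows and the first \<open>L\<close> columns cover \<open>\<lambda>\<close>.  By Greene's theorem there are \<open>K\<close> disjoint
  increasing and \<open>L\<close> disjoint decreasing subsequences of \<open>w\<close> as long in total as these rows and
  columns, and by counting each of the former meets each of the latter.  In the resulting
  \<open>K \<times> L\<close> grid keep the first \<open>\<mu>\<^sub>i\<close> letters of the \<open>i\<close>-th increasing subsequence.  The kept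
  letters are covered both by increasing subsequences of lengths \<open>\<mu>\<^sub>i\<close> and by decreasing ones of
  the conjugate lengths, so Greene's theorem bounds their shape by \<open>\<mu>\<close> from both sides in the
  dominance order.\<close>

section \<open>Coloured words and Knuth moves\<close>

text \<open>Colours \<open>< k\<close> stand for \<open>k\<close> disjoint increasing subsequences; the other letters are
  not covered.  Decreasing subsequences are handled as \<open>inc_col k f (rev w)\<close>.\<close>

definition inc_col :: "nat \<Rightarrow> ('a::linorder \<Rightarrow> nat) \<Rightarrow> 'a list \<Rightarrow> bool" where
  "inc_col k f w \<longleftrightarrow> sorted_wrt (\<lambda>u v. f u = f v \<longrightarrow> f u < k \<longrightarrow> u < v) w"

definition covered :: "nat \<Rightarrow> ('a \<Rightarrow> nat) \<Rightarrow> 'a list \<Rightarrow> nat" where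
  "covered k f w = length (filter (\<lambda>v. f v < k) w)"

lemma covered_simps [simp]:
  "covered k f [] = 0"
  "covered k f (x # w) = (if f x < k then 1 else 0) + covered k f w"
  "covered k f (u @ w) = covered k f u + covered k f w"
  "covered k f (rev w) = covered k f w"
  by (auto simp: covered_def rev_filter [symmetric])

lemma covered_cong: "(\<And>v. v \<in> set w \<Longrightarrow> f v < k \<longleftrightarrow> g v < k) \<Longrightarrow> covered k f w = covered k g w"
  by (auto simp: covered_def intro!: arg_cong [of _ _ length] filter_cong)

lemma covered_eq_card: "distinct w \<Longrightarrow> covered k f w = card {v \<in> set w. f v < k}"
  by (simp add: covered_def distinct_length_filter Int_def conj_commute)

text \<open>Only two of the four Knuth moves: they suffice to go from the reading word of the
  insertion tableau to the word, and they are closed under reversal.\<close>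

inductive knuth :: "'a::linorder list \<Rightarrow> 'a list \<Rightarrow> bool" where
  "x < y \<Longrightarrow> y < z \<Longrightarrow> knuth (p @ [y, x, z] @ q) (p @ [y, z, x] @ q)"
| "x < y \<Longrightarrow> y < z \<Longrightarrow> knuth (p @ [z, x, y] @ q) (p @ [x, z, y] @ q)"

lemma knuth_cong: "knuth u v \<Longrightarrow> knuth (p @ u @ q) (p @ v @ q)"
proof (induction rule: knuth.induct)
  case (1 x y z p' q')
  then show ?case using knuth.intros(1)[of x y z "p @ p'" "q' @ q"] by simp
next
  case (2 x y z p' q')
  then show ?case using knuth.intros(2)[of x y z "p @ p'" "q' @ q"] by simp
qed

lemma knuths_cong: "knuth\<^sup>*\<^sup>* u v \<Longrightarrow> knuth\<^sup>*\<^sup>* (p @ u @ q) (p @ v @ q)"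
  by (induction rule: rtranclp_induct) (auto intro: rtranclp.rtrancl_into_rtrancl knuth_cong)

lemma knuth_rev: "knuth u v \<Longrightarrow> knuth (rev u) (rev v)"
proof (induction rule: knuth.induct)
  case (1 x y z p q)
  then show ?case using knuth.intros(2)[of x y z "rev q" "rev p"] by simp
next
  case (2 x y z p q)
  then show ?case using knuth.intros(1)[of x y z "rev q" "rev p"] by simp
qed

lemma knuths_rev: "knuth\<^sup>*\<^sup>* u v \<Longrightarrow> knuth\<^sup>*\<^sup>* (rev u) (rev v)"
  by (induction rule: rtranclp_induct) (auto intro: rtranclp.rtrancl_into_rtrancl knuth_rev)

lemma knuth_mset: "knuth u v \<Longrightarrow> mset u = mset v"
  by (induction rule: knuth.induct) auto

lemma knuths_mset: "knuth\<^sup>*\<^sup>* u v \<Longrightarrow> mset u = mset v"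
  by (induction rule: rtranclp_induct) (auto dest: knuth_mset)

lemma knuths_distinct: "knuth\<^sup>*\<^sup>* u v \<Longrightarrow> distinct u \<longleftrightarrow> distinct v"
  using knuths_mset mset_eq_imp_distinct_iff by blast

text \<open>The second move puts \<open>x\<close> and \<open>z\<close> into ascending order, so
  every colouring survives it. The first breaks a colouring only if \<open>x\<close> and
  \<open>z\<close> lie on a common chain; then \<open>y\<close>, which lies between them in value,
  repairs it: either \<open>y\<close> replaces \<open>x\<close> on that chain, or two chains are
  recombined. Only the number of covered letters is preserved, not the set of them.\<close>

lemma inc_col_knuth:
  assumes "knuth w w'" "distinct w" "inc_col k f w"
  shows "\<exists>f'. inc_col k f' w' \<and> covered k f' w' = covered k f w"
  using assms
proof (induction rule: knuth.induct)
  case (1 x y z p q)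
  have ord: "x < y" "y < z" "x < z" using 1 by auto
  show ?case
  proof (cases "f x = f z \<and> f x < k")
    case False
    then have "inc_col k f (p @ [y, z, x] @ q)"
      using 1 ord by (auto simp: inc_col_def sorted_wrt_append)
    then show ?thesis by (intro exI[of _ f]) simp
  next
    case same: True
    then have yx: "f y \<noteq> f x"
      using 1 ord by (auto simp: inc_col_def sorted_wrt_append)
    have pp: "f u = f v \<Longrightarrow> f u < k \<Longrightarrow> u < v" if "u \<in> set p" "v \<in> set (y # x # z # q)" for u v
      using 1(4) that unfolding inc_col_def sorted_wrt_append by auto
    have qq: "f u = f v \<Longrightarrow> f u < k \<Longrightarrow> u < v" if "u \<in> {y, x, z}" "v \<in> set q" for u v
      using 1(4) that unfolding inc_col_def sorted_wrt_append by auto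
    have sp: "sorted_wrt (\<lambda>u v. f u = f v \<longrightarrow> f u < k \<longrightarrow> u < v) p"
      and sq: "sorted_wrt (\<lambda>u v. f u = f v \<longrightarrow> f u < k \<longrightarrow> u < v) q"
      using 1(4) unfolding inc_col_def sorted_wrt_append by auto
    show ?thesis
    proof (cases "f y < k")
      case False
      \<comment> \<open>Here \<open>y\<close> is uncovered and takes the place of \<open>x\<close>:
        it exceeds all that precedes \<open>x\<close> on the chain and is below \<open>z\<close>. In
        return \<open>x\<close> becomes uncovered.\<close>
      define h where "h = f(x := f y, y := f x)"
      have h: "h x = f y" "h y = f x" "h z = f z" "\<And>v. v \<noteq> x \<Longrightarrow> v \<noteq> y \<Longrightarrow> h v = f v"
        using ord by (auto simp: h_def)
      have pq: "a \<noteq> x \<and> a \<noteq> y \<and> a \<noteq> z" if "a \<in> set p \<union> set q" for a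
        using that 1 by auto
      have "sorted_wrt (\<lambda>u v. h u = h v \<longrightarrow> h u < k \<longrightarrow> u < v) p"
        by (rule sorted_wrt_mono_rel[OF _ sp]) (use pq h in auto)
      moreover have "sorted_wrt (\<lambda>u v. h u = h v \<longrightarrow> h u < k \<longrightarrow> u < v) q"
        by (rule sorted_wrt_mono_rel[OF _ sq]) (use pq h in auto)
      moreover have "h u = h v \<longrightarrow> h u < k \<longrightarrow> u < v" if "u \<in> set p" "v \<in> set ([y, z, x] @ q)" for u v
      proof -
        have "h u = f u" using pq that h by simp
        moreover have "f u = f x \<Longrightarrow> f u < k \<Longrightarrow> u < y" using pp[of u x] that ord by force
        moreover have "f u = f y \<Longrightarrow> \<not> f u < k" using False by simp
        ultimately show ?thesis using that pp[of u v] pq[of v] h same by auto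
      qed
      moreover have "h u = h v \<longrightarrow> h u < k \<longrightarrow> u < v" if "u \<in> set [y, z, x]" "v \<in> set q" for u v
      proof -
        have "h v = f v" using pq that h by simp
        moreover have "f z = f v \<Longrightarrow> f z < k \<Longrightarrow> y < v" using qq[of z v] that ord by force
        ultimately show ?thesis using that qq[of u v] False same yx ord h by auto
      qed
      moreover have "sorted_wrt (\<lambda>u v. h u = h v \<longrightarrow> h u < k \<longrightarrow> u < v) [y, z, x]"
        using ord same False yx h by auto
      ultimately have "inc_col k h (p @ [y, z, x] @ q)"
        unfolding inc_col_def sorted_wrt_append by auto
      moreover have "covered k h r = covered k f r" if "set r \<subseteq> set p \<union> set q" for r
        using that pq h by (intro covered_cong) auto
      ultimately show ?thesis using same False h by (intro exI[of _ h]) simp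
    next
      case True
      \<comment> \<open>The chains through \<open>y\<close> and through \<open>x, z\<close> exchange their tails.\<close>
      define t where "t = (\<lambda>c. if c = f x then f y else if c = f y then f x else c)"
      let ?f = "\<lambda>v. if v \<in> set (z # q) then t (f v) else f v"
      have tk: "t c < k \<longleftrightarrow> c < k" for c using same True by (auto simp: t_def)
      have tinj: "t c = t d \<longleftrightarrow> c = d" for c d by (auto simp: t_def)
      have pq: "a \<notin> set (z # q)" if "a \<in> set p \<union> {x, y}" for a
        using that 1 by auto
      have p: "inc_col k ?f p"
        unfolding inc_col_def by (rule sorted_wrt_mono_rel[OF _ sp]) (use pq in auto)
      have q: "inc_col k ?f q"
        unfolding inc_col_def by (rule sorted_wrt_mono_rel[OF _ sq]) (use tk tinj in auto)
      have fz: "t (f z) = f y" using same by (simp add: t_def)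
      \<comment> \<open>At the new joints a head ending at most at \<open>y\<close> meets a tail
        starting at least at \<open>z\<close>, and a head ending at most at \<open>x\<close> meets a
        tail lying above \<open>y\<close>.\<close>
      have c1: "?f u = ?f v \<longrightarrow> ?f u < k \<longrightarrow> u < v" if u: "u \<in> set p \<union> {y, x}" and v: "v \<in> set (z # q)" for u v
      proof (intro impI)
        assume eq: "?f u = ?f v" and "?f u < k"
        then have eq: "f u = t (f v)" and k: "f u < k" using pq[of u] u v by auto
        consider "f v = f x" "f u = f y" | "f v = f y" "f u = f x" | "f v = f u" "f v \<noteq> f x" "f v \<noteq> f y"
          using eq by (auto simp: t_def split: if_splits)
        then show "u < v"
        proof cases
          case 1
          then have "u \<le> y" using u pp[of u y] k yx by fastforce
          moreover have "z \<le> v" using v qq[of z v] 1 same by fastforce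
          ultimately show ?thesis using ord by auto
        next
          case 2
          then have "u \<le> x" using u pp[of u x] k yx by fastforce
          moreover have "y \<le> v" using v qq[of y v] 2 same yx True by fastforce
          ultimately show ?thesis using ord by auto
        next
          case 3
          then show ?thesis using u v pp[of u v] k by auto
        qed
      qed
      have "inc_col k ?f (p @ [y, z, x] @ q)"
        unfolding inc_col_def sorted_wrt_append
      proof (intro conjI ballI)
        show "sorted_wrt (\<lambda>u v. ?f u = ?f v \<longrightarrow> ?f u < k \<longrightarrow> u < v) p"
          "sorted_wrt (\<lambda>u v. ?f u = ?f v \<longrightarrow> ?f u < k \<longrightarrow> u < v) q"
          using p q by (simp_all add: inc_col_def)
        show "sorted_wrt (\<lambda>u v. ?f u = ?f v \<longrightarrow> ?f u < k \<longrightarrow> u < v) [y, z, x]"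
          using ord fz yx pq[of x] pq[of y] by auto
      next
        fix u v assume u: "u \<in> set p" and v: "v \<in> set ([y, z, x] @ q)"
        show "?f u = ?f v \<longrightarrow> ?f u < k \<longrightarrow> u < v"
        proof (cases "v \<in> set (z # q)")
          case True
          then show ?thesis using u by (intro c1) auto
        next
          case False
          then show ?thesis using u v pp[of u v] pq[of u] by auto
        qed
      next
        fix u v assume u: "u \<in> set [y, z, x]" and v: "v \<in> set q"
        show "?f u = ?f v \<longrightarrow> ?f u < k \<longrightarrow> u < v"
        proof (cases "u = z")
          case True
          then show ?thesis using v qq[of z v] tk tinj by auto
        next
          case False
          then show ?thesis using u v by (intro c1) auto
        qed
      qed
      moreover have "covered k ?f r = covered k f r" for r
        using tk by (intro covered_cong) auto
      ultimately show ?thesis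
        by (intro exI[of _ ?f]) (simp del: covered_simps(2), simp)
    qed
  qed
next
  case (2 x y z p q)
  then have "inc_col k f (p @ [x, z, y] @ q)"
    by (auto simp: inc_col_def sorted_wrt_append)
  then show ?case by (intro exI[of _ f]) simp
qed

lemma inc_col_knuths:
  assumes "knuth\<^sup>*\<^sup>* w w'" "distinct w" "inc_col k f w"
  shows "\<exists>f'. inc_col k f' w' \<and> covered k f' w' = covered k f w"
  using assms
proof (induction rule: rtranclp_induct)
  case base
  then show ?case by blast
next
  case (step v w')
  then show ?case using inc_col_knuth[of v w' k] knuths_distinct by metis
qed

section \<open>Row insertion\<close>

definition reading :: "'a tableau \<Rightarrow> 'a list" where
  "reading T = concat (rev T)"

lemma reading_simps [simp]: "reading [] = []" "reading (r # T) = reading T @ r"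
  by (simp_all add: reading_def)

lemma row_bump_cases:
  assumes "x \<notin> set r" "sorted_wrt (<) r"
  obtains "row_bump x r = (None, r @ [x])" "\<forall>a\<in>set r. a < x"
  | u y v where "r = u @ y # v" "row_bump x r = (Some y, u @ x # v)" "\<forall>a\<in>set u. a < x" "x < y"
proof -
  have "row_bump x r = (None, r @ [x]) \<and> (\<forall>a\<in>set r. a < x) \<or>
    (\<exists>u y v. r = u @ y # v \<and> row_bump x r = (Some y, u @ x # v) \<and> (\<forall>a\<in>set u. a < x) \<and> x < y)"
    using assms
  proof (induction r)
    case Nil
    then show ?case by simp
  next
    case (Cons a r)
    show ?case
    proof (cases "x < a")
      case True
      then show ?thesis by (intro disjI2 exI[of _ "[]"]) auto
    next
      case False
      then have a: "a < x" using Cons.prems by auto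
      consider "row_bump x r = (None, r @ [x])" "\<forall>a\<in>set r. a < x"
        | u y v where "r = u @ y # v" "row_bump x r = (Some y, u @ x # v)" "\<forall>a\<in>set u. a < x" "x < y"
        using Cons by auto
      then show ?thesis
      proof cases
        case 1
        then show ?thesis using a by auto
      next
        case 2
        then show ?thesis using a False by (intro disjI2 exI[of _ "a # u"]) auto
      qed
    qed
  qed
  then show thesis using that by blast
qed

text \<open>To pass a letter \<open>a\<close> of \<open>u\<close>, the letter \<open>y\<close> needs
  a neighbour with value between \<open>a\<close> and \<open>y\<close>. The letter right after
  \<open>a\<close> serves, which for the last \<open>a\<close> is \<open>x\<close> itself.\<close>

lemma knuths_move_left:
  assumes "sorted_wrt (<) u" "\<forall>a\<in>set u. a < x" "x < y"
  shows "knuth\<^sup>*\<^sup>* (y # u @ x # q) (u @ y # x # q)"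
  using assms
proof (induction u)
  case Nil
  then show ?case by simp
next
  case (Cons a u)
  obtain b s where b: "u @ x # q = b # s" by (cases u) auto
  have "a < b" "b < y" using Cons.prems b by (cases u; auto)+
  then have "knuth (y # a # u @ x # q) (a # y # u @ x # q)"
    using knuth.intros(2)[of a b y "[]" s] b by simp
  moreover have "knuth\<^sup>*\<^sup>* (a # y # u @ x # q) (a # u @ y # x # q)"
    using knuths_cong[of "y # u @ x # q" "u @ y # x # q" "[a]" "[]"] Cons by simp
  ultimately show ?case by simp
qed

text \<open>Here the witness for each move stands on the left: \<open>y\<close> lets
  \<open>x\<close> pass the next letter \<open>b\<close>, and then \<open>b\<close> is the witness
  for the letter after it.\<close>

lemma knuths_move_right:
  assumes "sorted_wrt (<) (y # v)" "x < y"
  shows "knuth\<^sup>*\<^sup>* (y # x # v) (y # v @ [x])"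
  using assms
proof (induction v arbitrary: y)
  case Nil
  then show ?case by simp
next
  case (Cons b v)
  have "knuth (y # x # b # v) (y # b # x # v)"
    using knuth.intros(1)[of x y b "[]" v] Cons.prems by simp
  moreover have "knuth\<^sup>*\<^sup>* (y # b # x # v) (y # b # v @ [x])"
    using knuths_cong[of "b # x # v" "b # v @ [x]" "[y]" "[]"] Cons by auto
  ultimately show ?case by simp
qed

text \<open>A bumped \<open>y\<close> is, by induction, first brought to the end of the reading of
  the lower rows, just before the row it left. From there it travels right to its old place next to
  \<open>x\<close>, and \<open>x\<close> then moves on to the end of the row.\<close>

lemma knuths_row_insert:
  assumes "\<forall>r\<in>set T. sorted_wrt (<) r" "distinct (reading T @ [x])"
  shows "knuth\<^sup>*\<^sup>* (reading (row_insert x T)) (reading T @ [x])"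
  using assms
proof (induction T arbitrary: x)
  case Nil
  then show ?case by simp
next
  case (Cons r T)
  have r: "sorted_wrt (<) r" "x \<notin> set r" using Cons.prems by auto
  from r(2,1) show ?case
  proof (cases rule: row_bump_cases)
    case 1
    then show ?thesis by simp
  next
    case (2 u y v)
    have uv: "sorted_wrt (<) u" "sorted_wrt (<) (y # v)" using r 2 by (auto simp: sorted_wrt_append)
    have "knuth\<^sup>*\<^sup>* (reading (row_insert y T)) (reading T @ [y])"
      using Cons.prems 2 by (intro Cons.IH) auto
    from knuths_cong[OF this, of "[]" "u @ x # v"]
    have "knuth\<^sup>*\<^sup>* (reading (row_insert x (r # T))) (reading T @ y # u @ x # v)"
      using 2 by simp
    also have "knuth\<^sup>*\<^sup>* \<dots> (reading T @ u @ y # x # v)"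
      using knuths_cong[OF knuths_move_left[OF uv(1) 2(3,4)], of "reading T" "[]"] by simp
    also have "knuth\<^sup>*\<^sup>* \<dots> (reading T @ u @ y # v @ [x])"
      using knuths_cong[OF knuths_move_right[OF uv(2) 2(4)], of "reading T @ u" "[]"] by simp
    finally show ?thesis using 2 by simp
  qed
qed

section \<open>Insertion preserves tableaux\<close>

definition row_below :: "'a::linorder list \<Rightarrow> 'a list \<Rightarrow> bool" where
  "row_below r s \<longleftrightarrow> length s \<le> length r \<and> (\<forall>j<length s. r ! j < s ! j)"

lemma row_below_trans: "row_below r s \<Longrightarrow> row_below s t \<Longrightarrow> row_below r t"
  unfolding row_below_def by (meson le_trans less_le_trans less_trans)

fun is_tableau :: "'a::linorder tableau \<Rightarrow> bool" where
  "is_tableau [] \<longleftrightarrow> True"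
| "is_tableau (r # T) \<longleftrightarrow> r \<noteq> [] \<and> sorted_wrt (<) r \<and> is_tableau T \<and>
     (case T of [] \<Rightarrow> True | s # _ \<Rightarrow> row_below r s)"

lemma is_tableau_rows: "is_tableau T \<Longrightarrow> r \<in> set T \<Longrightarrow> sorted_wrt (<) r \<and> r \<noteq> []"
  by (induction T) auto

text \<open>A bumped letter never lands further right than the place it left, because any entry of
  \<open>s\<close> beneath that place already exceeds it. So the entry above its new place is
  \<open>x\<close> or lies to the left of \<open>x\<close>, hence is smaller than \<open>y\<close>.
  In the other columns the upper entry can only decrease and the lower one is unchanged.\<close>

lemma row_below_bump:
  assumes "row_below (u @ y # v) s" "sorted_wrt (<) (u @ y # v)" "sorted_wrt (<) s"
    "x < y" "y \<notin> set s"
  shows "row_below (u @ x # v) (snd (row_bump y s))"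
proof -
  have le: "(u @ x # v) ! j \<le> (u @ y # v) ! j" if "j < length (u @ y # v)" for j
    using that assms(4) by (auto simp: nth_append nth_Cons split: nat.splits)
  have lt: "(u @ x # v) ! j < y" if "j \<le> length u" for j
    using that assms(2,4) by (auto simp: nth_append sorted_wrt_append nth_Cons split: nat.splits)
  from assms(5,3) show ?thesis
  proof (cases rule: row_bump_cases)
    case 1
    have len: "length s \<le> length u"
    proof (rule ccontr)
      assume "\<not> ?thesis"
      then have l: "length u < length s" by simp
      then have "(u @ y # v) ! length u < s ! length u"
        using assms(1) unfolding row_below_def by blast
      moreover have "s ! length u < y" using l 1(2) by simp
      ultimately show False by simp
    qed
    have "(u @ x # v) ! j < (s @ [y]) ! j" if "j < Suc (length s)" for j
    proof (cases "j = length s")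
      case True
      then show ?thesis using lt[of j] len by simp
    next
      case False
      then have j: "j < length s" using that by simp
      then have "(u @ x # v) ! j \<le> (u @ y # v) ! j" using len by (intro le) simp
      also have "\<dots> < s ! j" using assms(1) j by (simp add: row_below_def)
      finally show ?thesis using j by (simp add: nth_append)
    qed
    then show ?thesis using 1 len by (simp add: row_below_def)
  next
    case (2 a b c)
    have len: "length a \<le> length u"
    proof (rule ccontr)
      assume "\<not> ?thesis"
      then have l: "length u < length a" by simp
      then have "length u < length s" using 2(1) by simp
      then have "(u @ y # v) ! length u < s ! length u"
        using assms(1) unfolding row_below_def by blast
      moreover have "s ! length u < y" using l 2 by (simp add: nth_append)
      ultimately show False by simp
    qed
    have "(u @ x # v) ! j < (a @ y # c) ! j" if "j < length s" for j
    proof (cases "j = length a")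
      case True
      then show ?thesis using lt[of j] len by simp
    next
      case False
      have "j < length (u @ y # v)" using that assms(1) by (simp add: row_below_def)
      then have "(u @ x # v) ! j \<le> (u @ y # v) ! j" by (rule le)
      also have "\<dots> < s ! j" using assms(1) that by (simp add: row_below_def)
      also have "s ! j = (a @ y # c) ! j" using False 2 by (simp add: nth_append nth_Cons')
      finally show ?thesis .
    qed
    then show ?thesis using 2 assms(1) by (simp add: row_below_def)
  qed
qed

lemma is_tableau_row_insert:
  assumes "is_tableau T" "distinct (reading T @ [x])"
  shows "is_tableau (row_insert x T)"
  using assms
proof (induction T arbitrary: x)
  case Nil
  then show ?case by simp
next
  case (Cons r T)
  have r: "sorted_wrt (<) r" "x \<notin> set r" using Cons.prems by auto
  from r(2,1) show ?case
  proof (cases rule: row_bump_cases)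
    case 1
    then show ?thesis using Cons.prems
      by (auto simp: sorted_wrt_append row_below_def nth_append split: list.splits)
  next
    case (2 u y v)
    have sorted: "sorted_wrt (<) (u @ x # v)"
      using r 2 by (auto simp: sorted_wrt_append)
    have T: "is_tableau (row_insert y T)" using Cons.prems 2 by (intro Cons.IH) auto
    show ?thesis
    proof (cases T)
      case Nil
      have "(u @ x # v) ! 0 < y" using r 2 by (cases u) (auto simp: sorted_wrt_append)
      then show ?thesis using sorted T Nil 2 by (simp add: row_below_def)
    next
      case (Cons s T')
      have "row_below (u @ x # v) (snd (row_bump y s))"
        using Cons.prems r 2 Cons by (intro row_below_bump[of u y v]) auto
      moreover obtain T'' where "row_insert y T = snd (row_bump y s) # T''"
        using Cons by (cases "row_bump y s"; cases "fst (row_bump y s)") auto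
      ultimately show ?thesis using sorted T 2 by simp
    qed
  qed
qed

text \<open>The two claims are proved together: an insertion needs sorted rows and distinct letters
  in the tableau, and the latter comes from the Knuth path to \<open>w\<close>, which preserves the
  letters.\<close>

lemma insertion_tableau:
  assumes "distinct w"
  shows "is_tableau (fold row_insert w [])" "knuth\<^sup>*\<^sup>* (reading (fold row_insert w [])) w"
  using assms
proof (induction w rule: rev_induct)
  case Nil
  {
    case 1
    then show ?case by simp
  next
    case 2
    then show ?case by simp
  }
next
  case (snoc x w)
  let ?T = "fold row_insert w []"
  have w: "distinct w \<Longrightarrow> is_tableau ?T" "distinct w \<Longrightarrow> knuth\<^sup>*\<^sup>* (reading ?T) w"
    by (fact snoc.IH)+
  have d: "distinct (w @ [x]) \<Longrightarrow> distinct (reading ?T @ [x])"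
    using knuths_distinct[OF w(2)] mset_eq_setD[OF knuths_mset[OF w(2)]] by auto
  {
    case 1
    then show ?case using w(1) d by (auto intro!: is_tableau_row_insert)
  next
    case 2
    have "knuth\<^sup>*\<^sup>* (reading (row_insert x ?T)) (reading ?T @ [x])"
      using d[OF 2] w 2 is_tableau_rows by (intro knuths_row_insert) auto
    also have "knuth\<^sup>*\<^sup>* \<dots> (w @ [x])"
      using knuths_cong[OF w(2), of "[]" "[x]"] 2 by simp
    finally show ?case by simp
  }
qed

lemma shape_eq: "shape w = map length (fold row_insert w [])"
  by (simp add: shape_def fst_robinson_schensted tableau_shape_def)

section \<open>The shape is a partition of the length\<close>

lemma sum_list_shape:
  assumes "distinct w"
  shows "sum_list (shape w) = length w"
proof -
  have "sum_list (map length T) = length (reading T)" for T :: "'a tableau"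
    by (induction T) simp_all
  then show ?thesis
    using mset_eq_length[OF knuths_mset[OF insertion_tableau(2)[OF assms]]] by (simp add: shape_eq)
qed

lemma shape_positive: "distinct w \<Longrightarrow> \<forall>i\<in>set (shape w). 0 < i"
  using is_tableau_rows[OF insertion_tableau(1)] by (auto simp: shape_eq)

lemma sorted_shape:
  assumes "distinct w"
  shows "sorted_wrt (\<ge>) (shape w)"
proof -
  have "sorted_wrt (\<ge>) (map length T)" if "is_tableau T" for T :: "'a tableau"
    using that
  proof (induction T)
    case Nil
    then show ?case by simp
  next
    case (Cons r T)
    then show ?case by (cases T) (auto simp: row_below_def)
  qed
  then show ?thesis using insertion_tableau(1)[OF assms] by (simp add: shape_eq)
qed

section \<open>Greene's theorem\<close>

text \<open>Each row is a contiguous increasing factor of the reading word, so the first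
  \<open>k\<close> rows can serve as the chains.\<close>

lemma reading_rows:
  assumes "\<forall>r\<in>set T. sorted_wrt (<) r" "distinct (reading T)"
  shows "\<exists>f. inc_col k f (reading T) \<and> covered k f (reading T) = sum_list (take k (map length T))"
  using assms
proof (induction T arbitrary: k)
  case Nil
  then show ?case by (simp add: inc_col_def)
next
  case (Cons r T)
  show ?case
  proof (cases k)
    case 0
    have "sorted_wrt (\<lambda>u v. True) xs" for xs :: "'a list" by (induction xs) auto
    then show ?thesis using 0 by (simp add: inc_col_def covered_def)
  next
    case (Suc k')
    obtain f where f: "inc_col k' f (reading T)"
      "covered k' f (reading T) = sum_list (take k' (map length T))"
      using Cons.IH[of k'] Cons.prems by auto
    let ?f = "\<lambda>v. if v \<in> set r then 0 else Suc (f v)"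
    have disj: "a \<notin> set r" if "a \<in> set (reading T)" for a using Cons.prems that by auto
    have "inc_col k ?f (reading T)"
      using f(1) disj unfolding inc_col_def Suc
      by (auto intro: sorted_wrt_mono_rel[rotated])
    moreover have "inc_col k ?f r"
      using Cons.prems unfolding inc_col_def by (auto intro: sorted_wrt_mono_rel[rotated])
    ultimately have "inc_col k ?f (reading (r # T))"
      using disj unfolding inc_col_def by (auto simp: sorted_wrt_append)
    moreover have "covered k ?f (reading T) = covered k' f (reading T)"
      unfolding covered_def Suc
      by (intro arg_cong[of _ _ length] filter_cong refl) (use disj in auto)
    moreover have "covered k ?f r = length r" unfolding covered_def using Suc by simp
    ultimately show ?thesis using f(2) Suc by (intro exI[of _ ?f]) simp
  qed
qed

text \<open>The reading word lists lower rows first, so every column appears in it as a decreasing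
  subsequence, and the column index is the colour. The last conjunct carries this through the
  induction, where a new top row must be matched with the columns below it.\<close>

lemma reading_columns:
  assumes "is_tableau T" "distinct (reading T)"
  shows "\<exists>g. inc_col k g (rev (reading T)) \<and>
    covered k g (reading T) = sum_list (map (min k) (map length T)) \<and>
    (\<forall>r\<in>set T. \<forall>j<length r. g (r ! j) = j)"
  using assms
proof (induction T)
  case Nil
  then show ?case by (simp add: inc_col_def)
next
  case (Cons r T)
  obtain g where g: "inc_col k g (rev (reading T))"
    "covered k g (reading T) = sum_list (map (min k) (map length T))"
    "\<forall>r\<in>set T. \<forall>j<length r. g (r ! j) = j"
    using Cons by auto
  define c where "c = inv_into {..<length r} ((!) r)"
  have dr: "distinct r" using Cons.prems by simp
  then have c: "c (r ! j) = j" if "j < length r" for j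
    unfolding c_def using that by (intro inv_into_f_f inj_onI) (auto simp: nth_eq_iff_index_eq)
  let ?g = "\<lambda>v. if v \<in> set r then c v else g v"
  have disj: "a \<notin> set r" if "a \<in> set (reading T)" for a using Cons.prems that by auto
  have sorted: "sorted_wrt (<) r" using Cons.prems by simp
  have col: "?g (s ! j) = j" if "s \<in> set (r # T)" "j < length s" for s j
  proof (cases "s = r")
    case True
    then show ?thesis using c that by simp
  next
    case False
    then have "s \<in> set T" using that by simp
    then have "s ! j \<in> set (reading T)" using that(2) by (auto simp: reading_def intro!: bexI[of _ s])
    then show ?thesis using disj g(3) \<open>s \<in> set T\<close> that(2) by auto
  qed
  \<comment> \<open>The witness is the entry of \<open>r\<close> in the column of \<open>v\<close>;
    transitivity extends the comparison of adjacent rows to all lower rows.\<close>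
  have below: "\<exists>i<length r. r ! i < v \<and> c (r ! i) = g v" if "v \<in> set (reading T)" for v
  proof -
    have "\<forall>s\<in>set T. row_below r s"
      using Cons.prems(1)
    proof (induction T arbitrary: r)
      case Nil
      then show ?case by simp
    next
      case (Cons s T)
      have "row_below r s" "\<forall>s'\<in>set T. row_below s s'" using Cons by auto
      then show ?case by (auto intro: row_below_trans)
    qed
    moreover obtain s j where s: "s \<in> set T" "j < length s" "v = s ! j"
      using \<open>v \<in> set (reading T)\<close> by (auto simp: reading_def in_set_conv_nth[of v])
    ultimately have "j < length r" "r ! j < v" by (auto simp: row_below_def)
    then show ?thesis using s g(3) c by auto
  qed
  have "inc_col k ?g (rev (reading T))"
    using g(1) disj unfolding inc_col_def by (auto intro: sorted_wrt_mono_rel[rotated])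
  moreover have "inc_col k ?g (rev r)"
  proof -
    have "sorted_wrt (\<lambda>u v. c u \<noteq> c v) (rev r)"
      unfolding sorted_wrt_rev by (simp add: sorted_wrt_iff_nth_less c)
    then show ?thesis unfolding inc_col_def by (auto intro: sorted_wrt_mono_rel[rotated])
  qed
  moreover have "a < v" if a: "a \<in> set r" and v: "v \<in> set (reading T)" and "?g a = ?g v" for a v
  proof -
    obtain i where i: "i < length r" "r ! i < v" "c (r ! i) = g v" using below[OF v] by blast
    obtain j where j: "j < length r" "a = r ! j" using a by (auto simp: in_set_conv_nth)
    then have "j = i" using that disj[OF v] i c by auto
    then show ?thesis using i j by simp
  qed
  ultimately have "inc_col k ?g (rev (reading (r # T)))"
    unfolding inc_col_def by (auto simp: sorted_wrt_append)
  moreover have "covered k ?g (reading (r # T)) = sum_list (map (min k) (map length (r # T)))"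
  proof -
    have "covered k ?g (reading T) = covered k g (reading T)"
      by (intro covered_cong) (use disj in auto)
    moreover have "covered k ?g r = card {i. i < length r \<and> i < k}"
      unfolding covered_def length_filter_conv_card using c
      by (intro arg_cong[of _ _ card]) auto
    moreover have "{i. i < length r \<and> i < k} = {..<min k (length r)}" by auto
    ultimately show ?thesis using g(2) by simp
  qed
  ultimately show ?case using col by blast
qed

text \<open>The rows give a colouring of the reading word, and the Knuth path transports it to
  \<open>w\<close>. This is the existence half; maximality is
  \<open>greene_increasing_bound\<close>.\<close>

lemma greene_increasing:
  assumes "distinct w"
  shows "\<exists>f. inc_col k f w \<and> covered k f w = sum_list (take k (shape w))"
proof -
  let ?T = "fold row_insert w []"
  have T: "is_tableau ?T" "knuth\<^sup>*\<^sup>* (reading ?T) w" using insertion_tableau assms by auto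
  then have d: "distinct (reading ?T)" using knuths_distinct assms by blast
  obtain f where "inc_col k f (reading ?T)" "covered k f (reading ?T) = sum_list (take k (shape w))"
    using reading_rows[of ?T k] is_tableau_rows T(1) d by (auto simp: shape_eq)
  with inc_col_knuths[OF T(2) d, of k f] show ?thesis by auto
qed

text \<open>Dually, with columns and the reversed Knuth path. The sum with \<open>min l\<close>
  counts the boxes in the first \<open>l\<close> columns.\<close>

lemma greene_decreasing:
  assumes "distinct w"
  shows "\<exists>g. inc_col l g (rev w) \<and> covered l g w = sum_list (map (min l) (shape w))"
proof -
  let ?T = "fold row_insert w []"
  have T: "is_tableau ?T" "knuth\<^sup>*\<^sup>* (reading ?T) w" using insertion_tableau assms by auto
  then have d: "distinct (reading ?T)" using knuths_distinct assms by blast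
  obtain g where "inc_col l g (rev (reading ?T))"
    "covered l g (rev (reading ?T)) = sum_list (map (min l) (shape w))"
    using reading_columns[OF T(1) d, of l] unfolding shape_eq covered_simps(4) by blast
  moreover have "distinct (rev (reading ?T))" using d by simp
  ultimately obtain g' where "inc_col l g' (rev w)"
    "covered l g' (rev w) = sum_list (map (min l) (shape w))"
    using inc_col_knuths[OF knuths_rev[OF T(2)]] by metis
  then show ?thesis by auto
qed

text \<open>One \<open>pos\<close> serves all relations at once, so increasing and decreasing
  conditions on the same word can be compared pairwise, without reference to the list.\<close>

lemma distinct_positions:
  assumes "distinct (w :: 'a list)"
  shows "\<exists>pos :: 'a \<Rightarrow> nat. inj_on pos (set w) \<and>
    (\<forall>R. sorted_wrt R w \<longleftrightarrow> (\<forall>u\<in>set w. \<forall>v\<in>set w. pos u < pos v \<longrightarrow> R u v))"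
proof -
  define pos where "pos = inv_into {..<length w} ((!) w)"
  have pos: "pos (w ! i) = i" if "i < length w" for i
    unfolding pos_def using that assms
    by (intro inv_into_f_f inj_onI) (auto simp: nth_eq_iff_index_eq)
  have "inj_on pos (set w)" using pos by (auto simp: in_set_conv_nth inj_on_def)
  moreover have "sorted_wrt R w \<longleftrightarrow> (\<forall>u\<in>set w. \<forall>v\<in>set w. pos u < pos v \<longrightarrow> R u v)" for R
  proof -
    have "set w = (!) w ` {..<length w}" by (auto simp: in_set_conv_nth)
    then show ?thesis using pos by (auto simp: sorted_wrt_iff_nth_less)
  qed
  ultimately show ?thesis by blast
qed

text \<open>An increasing and a decreasing subsequence share at most one letter.\<close>

lemma inc_dec_inj:
  assumes "distinct w" "inc_col k f w" "inc_col l g (rev w)"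
  shows "inj_on (\<lambda>v. (f v, g v)) {v \<in> set w. f v < k \<and> g v < l}"
proof (rule inj_onI)
  let ?S = "{v \<in> set w. f v < k \<and> g v < l}"
  fix u v assume *: "u \<in> ?S" "v \<in> ?S" "(f u, g u) = (f v, g v)"
  obtain pos :: "'a \<Rightarrow> nat" where pos: "inj_on pos (set w)"
    and sorted: "\<And>R. sorted_wrt R w \<longleftrightarrow> (\<forall>u\<in>set w. \<forall>v\<in>set w. pos u < pos v \<longrightarrow> R u v)"
    using distinct_positions[OF assms(1)] by blast
  have contra: False if "u \<in> ?S" "v \<in> ?S" "f u = f v" "g u = g v" "pos u < pos v" for u v
  proof -
    have "u < v"
      using assms(2)[unfolded inc_col_def sorted, rule_format, of u v] that by simp
    moreover have "v < u"
      using assms(3)[unfolded inc_col_def sorted_wrt_rev sorted, rule_format, of u v] that by simp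
    ultimately show False by simp
  qed
  have eq: "f u = f v" "g u = g v" using *(3) by simp_all
  have "\<not> pos u < pos v"
    by (rule notI) (rule contra[OF *(1,2) eq])
  moreover have "\<not> pos v < pos u"
    by (rule notI) (rule contra[OF *(2,1) eq[symmetric]])
  ultimately have "pos u = pos v" by simp
  moreover have "u \<in> set w" "v \<in> set w" using *(1,2) by simp_all
  ultimately show "u = v" by (rule inj_onD[OF pos])
qed

text \<open>Inclusion-exclusion for the two covered sets. Combined with
  \<open>sum_rows_columns\<close> it yields both maximality halves of Greene's theorem and, in the
  case of equality, the grid.\<close>

lemma inc_dec_bound:
  assumes "distinct w" "inc_col k f w" "inc_col l g (rev w)"
  shows "covered k f w + covered l g w \<le> length w + card {v \<in> set w. f v < k \<and> g v < l}"
    and "card {v \<in> set w. f v < k \<and> g v < l} \<le> k * l"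
proof -
  let ?A = "{v \<in> set w. f v < k}" and ?B = "{v \<in> set w. g v < l}"
  have "card ?A + card ?B = card (?A \<union> ?B) + card (?A \<inter> ?B)" by (rule card_Un_Int) auto
  moreover have "?A \<inter> ?B = {v \<in> set w. f v < k \<and> g v < l}" by auto
  moreover have "card (?A \<union> ?B) \<le> card (set w)" by (rule card_mono) auto
  ultimately show "covered k f w + covered l g w \<le> length w + card {v \<in> set w. f v < k \<and> g v < l}"
    using assms(1) by (simp add: covered_eq_card distinct_card)
  have "card {v \<in> set w. f v < k \<and> g v < l} \<le> card ({..<k} \<times> {..<l})"
    by (rule card_inj_on_le[OF inc_dec_inj[OF assms]]) auto
  then show "card {v \<in> set w. f v < k \<and> g v < l} \<le> k * l" by simp
qed

section \<open>Partitions\<close>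

lemma part_simps [simp]: "part [] i = 0" "part (n # \<nu>) 0 = n" "part (n # \<nu>) (Suc i) = part \<nu> i"
  by (auto simp: part_def)

lemma part_antimono: "sorted_wrt (\<ge>) \<nu> \<Longrightarrow> i \<le> j \<Longrightarrow> part \<nu> j \<le> part \<nu> i"
  by (cases "i = j") (auto simp: part_def sorted_wrt_iff_nth_less)

lemma sum_list_take_Suc: "sum_list (take (Suc r) \<nu>) = sum_list (take r \<nu>) + part \<nu> r"
  by (cases "r < length \<nu>") (auto simp: part_def take_Suc_conv_app_nth)

text \<open>Rows \<open>< r\<close> and columns \<open>< l\<close> of a diagram meet in at most \<open>r * l\<close> boxes; in the situation
  of the second lemma they meet in exactly that many boxes and cover the diagram.\<close>

lemma sum_rows_columns_le: "sum_list (take r \<nu>) + sum_list (map (min l) \<nu>) \<le> sum_list \<nu> + r * (l::nat)"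
proof (induction \<nu> arbitrary: r)
  case Nil
  then show ?case by simp
next
  case (Cons n \<nu>)
  show ?case using Cons.IH[of 0] Cons.IH[of "r - 1"] by (cases r) auto
qed

lemma sum_rows_columns:
  assumes "\<And>i. i < r \<Longrightarrow> l \<le> part \<nu> i" "\<And>i. r \<le> i \<Longrightarrow> part \<nu> i \<le> l"
  shows "sum_list (take r \<nu>) + sum_list (map (min l) \<nu>) = sum_list \<nu> + r * l"
  using assms
proof (induction \<nu> arbitrary: r)
  case Nil
  show ?case using Nil(1)[of 0] by (cases r) auto
next
  case (Cons n \<nu>)
  show ?case
  proof (cases r)
    case 0
    have "n \<le> l" "sum_list (map (min l) \<nu>) = sum_list \<nu>"
      using Cons.IH[of 0] Cons.prems(2)[of 0] Cons.prems(2)[of "Suc i" for i] 0 by auto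
    then show ?thesis using 0 by simp
  next
    case (Suc r')
    have "sum_list (take r' \<nu>) + sum_list (map (min l) \<nu>) = sum_list \<nu> + r' * l"
      using Cons.prems(1)[of "Suc i" for i] Cons.prems(2)[of "Suc i" for i] Suc
      by (intro Cons.IH) auto
    moreover have "l \<le> n" using Cons.prems(1)[of 0] Suc by simp
    ultimately show ?thesis using Suc by simp
  qed
qed

lemma partition_eqI:
  assumes "\<And>i. part \<mu> i = part \<nu> i" "\<forall>i\<in>set \<mu>. 0 < i" "\<forall>i\<in>set \<nu>. 0 < i"
  shows "\<mu> = \<nu>"
proof (rule nth_equalityI)
  have pos: "0 < part \<kappa> i \<longleftrightarrow> i < length \<kappa>" if "\<forall>i\<in>set \<kappa>. 0 < i" for \<kappa> i
    using that by (auto simp: part_def)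
  have "i < length \<mu> \<longleftrightarrow> i < length \<nu>" for i using assms pos by metis
  then show len: "length \<mu> = length \<nu>" by (meson linorder_neqE_nat less_irrefl)
  fix i assume "i < length \<mu>"
  then show "\<mu> ! i = \<nu> ! i" using assms(1)[of i] len by (simp add: part_def)
qed

text \<open>The row sums say that \<open>\<nu>\<close> dominates \<open>\<mu>\<close>. The column
  sums say the same of the conjugates, which reverses dominance. Instead of conjugating, the proof
  compares the parts one at a time by covering diagrams with rows and columns.\<close>

lemma partition_eq_dominance:
  fixes \<mu> \<nu> :: "nat list"
  assumes "sorted_wrt (\<ge>) \<mu>" "sum_list \<mu> = sum_list \<nu>"
    "\<forall>i\<in>set \<mu>. 0 < i" "\<forall>i\<in>set \<nu>. 0 < i"
    and rows: "\<And>r. sum_list (take r \<mu>) \<le> sum_list (take r \<nu>)"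
    and columns: "\<And>l. sum_list (map (min l) \<mu>) \<le> sum_list (map (min l) \<nu>)"
  shows "\<mu> = \<nu>"
proof -
  have eq: "part \<mu> r = part \<nu> r" if "sum_list (take r \<mu>) = sum_list (take r \<nu>)" for r
  proof -
    have "part \<mu> r \<le> part \<nu> r" using rows[of "Suc r"] that by (simp add: sum_list_take_Suc)
    \<comment> \<open>With \<open>part \<mu> r\<close> columns, \<open>r\<close> rows and these
      columns cover \<open>\<mu>\<close> exactly. For \<open>\<nu>\<close> one more row is taken, so
      that subtracting leaves \<open>part \<nu> r \<le> part \<mu> r\<close>.\<close>
    moreover have "sum_list (take r \<mu>) + sum_list (map (min (part \<mu> r)) \<mu>) = sum_list \<mu> + r * part \<mu> r"
      using part_antimono[OF assms(1)] by (intro sum_rows_columns) auto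
    moreover have "sum_list (take (Suc r) \<nu>) + sum_list (map (min (part \<mu> r)) \<nu>)
        \<le> sum_list \<nu> + Suc r * part \<mu> r"
      by (rule sum_rows_columns_le)
    ultimately show ?thesis
      using that assms(2) columns[of "part \<mu> r"] by (simp add: sum_list_take_Suc)
  qed
  have "sum_list (take r \<mu>) = sum_list (take r \<nu>)" for r
    by (induction r) (simp_all add: sum_list_take_Suc eq)
  then show ?thesis using eq assms by (intro partition_eqI) auto
qed

section \<open>Maximality in Greene's theorem\<close>

lemma greene_increasing_bound:
  assumes "distinct w" "inc_col r f w"
  shows "covered r f w \<le> sum_list (take r (shape w))"
proof -
  \<comment> \<open>The number of columns is chosen so that they and the first \<open>r\<close> rows
    cover the shape. Optimal decreasing subsequences for these columns then leave no room for a
    larger increasing cover.\<close>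
  let ?l = "part (shape w) r"
  obtain g where g: "inc_col ?l g (rev w)" "covered ?l g w = sum_list (map (min ?l) (shape w))"
    using greene_decreasing assms(1) by blast
  have "sum_list (take r (shape w)) + sum_list (map (min ?l) (shape w)) = sum_list (shape w) + r * ?l"
    using part_antimono[OF sorted_shape[OF assms(1)]] by (intro sum_rows_columns) auto
  then show ?thesis using inc_dec_bound[OF assms g(1)] g(2) sum_list_shape[OF assms(1)] by linarith
qed

lemma greene_decreasing_bound:
  assumes "distinct w" "inc_col l g (rev w)"
  shows "covered l g w \<le> sum_list (map (min l) (shape w))"
proof -
  \<comment> \<open>The number of rows longer than \<open>l\<close>; it exists because
    \<open>part\<close> is 0 beyond the last row.\<close>
  define r where "r = (LEAST r. part (shape w) r \<le> l)"
  have "part (shape w) (length (shape w)) \<le> l" by (simp add: part_def)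
  then have r: "part (shape w) r \<le> l" unfolding r_def by (rule LeastI)
  have less: "l \<le> part (shape w) i" if "i < r" for i
    using not_less_Least[of i] that unfolding r_def by force
  obtain f where f: "inc_col r f w" "covered r f w = sum_list (take r (shape w))"
    using greene_increasing assms(1) by blast
  have "sum_list (take r (shape w)) + sum_list (map (min l) (shape w)) = sum_list (shape w) + r * l"
    using r less part_antimono[OF sorted_shape[OF assms(1)]] by (intro sum_rows_columns) (auto intro: le_trans)
  then show ?thesis using inc_dec_bound[OF assms(1) f(1) assms(2)] f(2) sum_list_shape[OF assms(1)]
    by linarith
qed

section \<open>Grids\<close>

text \<open>The antichains given by \<open>g\<close> need not be met in the same order by all chains, so they are
  replaced by the sets of \<open>j\<close>-th elements of the chains.  Two increasing \<open>j\<close>-th elements would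
  join the lower part of one chain to the upper part of another, giving a chain of \<open>L + 1\<close>
  elements, too many for \<open>L\<close> antichains.\<close>

lemma grid_levels:
  fixes S :: "'a::linorder set" and pos f g :: "'a \<Rightarrow> nat"
  assumes bij: "bij_betw (\<lambda>v. (f v, g v)) S ({..<K} \<times> {..<L})"
    and f: "\<And>u v. u \<in> S \<Longrightarrow> v \<in> S \<Longrightarrow> pos u < pos v \<Longrightarrow> f u = f v \<Longrightarrow> u < v"
    and g: "\<And>u v. u \<in> S \<Longrightarrow> v \<in> S \<Longrightarrow> pos u < pos v \<Longrightarrow> g u = g v \<Longrightarrow> v < u"
  shows "\<exists>h. bij_betw (\<lambda>v. (f v, h v)) S ({..<K} \<times> {..<L}) \<and>
    (\<forall>u\<in>S. \<forall>v\<in>S. pos u < pos v \<longrightarrow> h u = h v \<longrightarrow> v < u)"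
proof -
  have fin: "finite S" using bij_betw_finite[OF bij] by simp
  define h where "h v = card {u \<in> S. f u = f v \<and> u < v}" for v
  have mono: "h u < h v" if "u \<in> S" "v \<in> S" "f u = f v" "u < v" for u v
    unfolding h_def using that fin by (intro psubset_card_mono) auto
  have gL: "g v < L" "f v < K" if "v \<in> S" for v using bij that by (auto dest: bij_betwE)
  have chain: "card {u \<in> S. f u = f v} = L" if "v \<in> S" for v
  proof -
    have "bij_betw (\<lambda>v. (f v, g v)) {u \<in> S. f u = f v} ({f v} \<times> {..<L})"
      unfolding bij_betw_def
    proof
      show "inj_on (\<lambda>v. (f v, g v)) {u \<in> S. f u = f v}"
        using bij by (auto simp: bij_betw_def intro: inj_on_subset)
      have "\<exists>u\<in>S. f u = f v \<and> g u = j" if "j < L" for j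
      proof -
        have "(f v, j) \<in> (\<lambda>v. (f v, g v)) ` S"
          using bij that gL[OF \<open>v \<in> S\<close>] by (simp add: bij_betw_def)
        then show ?thesis by auto
      qed
      then show "(\<lambda>v. (f v, g v)) ` {u \<in> S. f u = f v} = {f v} \<times> {..<L}"
        using gL by (auto simp: image_iff)
    qed
    then show ?thesis by (simp add: bij_betw_same_card)
  qed
  \<comment> \<open>The part of a chain from \<open>v\<close> upwards, \<open>v\<close> included,
    has \<open>L - h v\<close> elements.\<close>
  have upper: "h v + card {u \<in> S. f u = f v \<and> v \<le> u} = L" if "v \<in> S" for v
  proof -
    have "{u \<in> S. f u = f v} = {u \<in> S. f u = f v \<and> u < v} \<union> {u \<in> S. f u = f v \<and> v \<le> u}" by auto
    then have "card {u \<in> S. f u = f v} = h v + card {u \<in> S. f u = f v \<and> v \<le> u}"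
      unfolding h_def using fin by (simp only:) (rule card_Un_disjoint, auto)
    then show ?thesis using chain[OF that] by simp
  qed
  have hL: "h v < L" if "v \<in> S" for v
  proof -
    have "0 < card {u \<in> S. f u = f v \<and> v \<le> u}" using that fin by (auto simp: card_gt_0_iff)
    then show ?thesis using upper[OF that] by simp
  qed
  have inj: "inj_on (\<lambda>v. (f v, h v)) S"
  proof (rule inj_onI)
    fix u v assume "u \<in> S" "v \<in> S" "(f u, h u) = (f v, h v)"
    then show "u = v" using mono[of u v] mono[of v u] by (cases u v rule: linorder_cases) auto
  qed
  have "(\<lambda>v. (f v, h v)) ` S = {..<K} \<times> {..<L}"
  proof (rule card_subset_eq)
    show "(\<lambda>v. (f v, h v)) ` S \<subseteq> {..<K} \<times> {..<L}" using gL hL by auto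
    show "card ((\<lambda>v. (f v, h v)) ` S) = card ({..<K} \<times> {..<L})"
      using card_image[OF inj] bij_betw_same_card[OF bij] by simp
  qed simp
  with inj have "bij_betw (\<lambda>v. (f v, h v)) S ({..<K} \<times> {..<L})" by (simp add: bij_betw_def)
  moreover have "v < u" if uv: "u \<in> S" "v \<in> S" "pos u < pos v" "h u = h v" for u v
  proof (rule ccontr)
    assume "\<not> v < u"
    then have less: "u < v" using uv by (cases u v rule: linorder_cases) auto
    then have ne: "f u \<noteq> f v" using mono[of u v] uv by auto
    \<comment> \<open>Equal levels make the sizes \<open>h u + 1\<close> and \<open>L - h v\<close>
      add up to \<open>L + 1\<close>.\<close>
    define X Y where "X = {t \<in> S. f t = f u \<and> t \<le> u}" and "Y = {t \<in> S. f t = f v \<and> v \<le> t}"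
    have "X = insert u {t \<in> S. f t = f u \<and> t < u}" using uv by (auto simp: X_def)
    then have "card X = Suc (h u)" unfolding h_def using fin by simp
    moreover have "X \<inter> Y = {}" "finite X" "finite Y" using ne fin by (auto simp: X_def Y_def)
    ultimately have "card (X \<union> Y) = Suc L"
      using upper[OF uv(2)] uv(4) by (simp add: card_Un_disjoint Y_def)
    moreover have X: "t \<in> S" "pos t \<le> pos u" "t \<le> u" if "t \<in> X" for t
      using that f[of u t] uv(1) by (force simp: X_def)+
    moreover have Y: "t \<in> S" "pos v \<le> pos t" "v \<le> t" if "t \<in> Y" for t
      using that f[of t v] uv(2) by (force simp: Y_def)+
    have "inj_on g (X \<union> Y)"
    proof (rule inj_onI)
      fix s t assume st: "s \<in> X \<union> Y" "t \<in> X \<union> Y" and eq: "g s = g t"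
      have S: "s \<in> S" "t \<in> S" using st X Y by auto
      \<comment> \<open>All of \<open>X\<close> lies before and below all of \<open>Y\<close>,
        whereas equal values of \<open>g\<close> would force a descent.\<close>
      have cross: False if "s \<in> X" "t \<in> Y" "g s = g t" for s t
        using g[of s t] X[OF that(1)] Y[OF that(2)] that uv(3) less by auto
      show "s = t"
      proof (cases "f s = f t")
        case True
        then show ?thesis using bij S eq by (auto simp: bij_betw_def inj_on_def)
      next
        case False
        then have "s \<in> X \<and> t \<in> Y \<or> s \<in> Y \<and> t \<in> X" using st by (auto simp: X_def Y_def)
        then show ?thesis using cross eq by metis
      qed
    qed
    then have "card (X \<union> Y) \<le> card {..<L}"
      by (rule card_inj_on_le) (use X Y gL in auto)
    ultimately show False by simp
  qed
  ultimately show ?thesis by blast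
qed

lemma grid_exists:
  assumes "distinct w" "0 < k" "a \<le> part (shape w) (k - 1)"
  obtains K L f g where "k \<le> K" "a \<le> L" "inc_col K f w" "inc_col L g (rev w)"
    "bij_betw (\<lambda>v. (f v, g v)) {v \<in> set w. f v < K \<and> g v < L} ({..<K} \<times> {..<L})"
proof -
  \<comment> \<open>The rectangle with \<open>k + d\<close> rows and \<open>a + d\<close> columns
    fits; its last row has index \<open>k - 1 + d\<close>, as \<open>part\<close> counts from
    0.\<close>
  let ?P = "\<lambda>d. a + d \<le> part (shape w) (k - 1 + d)"
  define d where "d = (GREATEST d. ?P d)"
  have bounded: "d \<le> part (shape w) 0" if "?P d" for d
    using that part_antimono[OF sorted_shape[OF assms(1)], of 0 "k - 1 + d"] by simp
  have d: "?P d" unfolding d_def by (rule GreatestI_nat[of ?P 0]) (use assms bounded in auto)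
  \<comment> \<open>Maximality bounds row \<open>K\<close> of the shape, the first one below the
    rectangle, by \<open>L\<close>. Hence the first \<open>K\<close> rows and \<open>L\<close>
    columns cover the shape.\<close>
  have nd: "\<not> ?P (Suc d)"
    using Greatest_le_nat[of ?P "Suc d" "part (shape w) 0"] bounded unfolding d_def by auto
  define K L where "K = k + d" and "L = a + d"
  obtain f where f: "inc_col K f w" "covered K f w = sum_list (take K (shape w))"
    using greene_increasing assms(1) by blast
  obtain g where g: "inc_col L g (rev w)" "covered L g w = sum_list (map (min L) (shape w))"
    using greene_decreasing assms(1) by blast
  let ?S = "{v \<in> set w. f v < K \<and> g v < L}"
  have "sum_list (take K (shape w)) + sum_list (map (min L) (shape w)) = sum_list (shape w) + K * L"
  proof (rule sum_rows_columns)
    fix i assume "i < K"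
    then have "part (shape w) (k - 1 + d) \<le> part (shape w) i"
      using assms(2) by (intro part_antimono sorted_shape assms(1)) (auto simp: K_def)
    then show "L \<le> part (shape w) i" using d by (simp add: L_def)
  next
    fix i assume "K \<le> i"
    then have "part (shape w) i \<le> part (shape w) (k - 1 + Suc d)"
      using assms(2) by (intro part_antimono sorted_shape assms(1)) (auto simp: K_def)
    then show "part (shape w) i \<le> L" using nd by (simp add: L_def)
  qed
  \<comment> \<open>The lower and the upper estimate of \<open>inc_dec_bound\<close> coincide, so
    the injection into the grid is onto.\<close>
  then have card: "card ?S = K * L"
    using inc_dec_bound[OF assms(1) f(1) g(1)] f(2) g(2) sum_list_shape[OF assms(1)] by linarith
  have inj: "inj_on (\<lambda>v. (f v, g v)) ?S" using inc_dec_inj[OF assms(1) f(1) g(1)] .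
  have "(\<lambda>v. (f v, g v)) ` ?S = {..<K} \<times> {..<L}"
    by (rule card_subset_eq) (auto simp: card_image[OF inj] card)
  with inj have "bij_betw (\<lambda>v. (f v, g v)) ?S ({..<K} \<times> {..<L})" by (simp add: bij_betw_def)
  then show thesis using f g by (intro that[of K L f g]) (auto simp: K_def L_def)
qed

section \<open>Cutting the diagram of \<open>\<mu>\<close> out of the grid\<close>

lemma subseq_with_shape:
  fixes w :: "'a::linorder list"
  assumes w: "distinct w" and \<mu>: "sorted_wrt (\<ge>) \<mu>" "\<forall>i\<in>set \<mu>. 0 < i" "\<mu> \<noteq> []"
    and rect: "hd \<mu> \<le> part (shape w) (length \<mu> - 1)"
  shows "\<exists>\<sigma>. subseq \<sigma> w \<and> shape \<sigma> = \<mu>"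
proof -
  have "0 < length \<mu>" using \<mu>(3) by simp
  then obtain K L f g where KL: "length \<mu> \<le> K" "hd \<mu> \<le> L"
    and f: "inc_col K f w" and g: "inc_col L g (rev w)"
    and bij: "bij_betw (\<lambda>v. (f v, g v)) {v \<in> set w. f v < K \<and> g v < L} ({..<K} \<times> {..<L})"
    by (rule grid_exists[OF w _ rect])
  define S where "S = {v \<in> set w. f v < K \<and> g v < L}"
  obtain pos :: "'a \<Rightarrow> nat" where
    sorted: "\<And>R. sorted_wrt R w \<longleftrightarrow> (\<forall>u\<in>set w. \<forall>v\<in>set w. pos u < pos v \<longrightarrow> R u v)"
    using distinct_positions[OF w] by blast
  have "\<exists>h. bij_betw (\<lambda>v. (f v, h v)) S ({..<K} \<times> {..<L}) \<and>
    (\<forall>u\<in>S. \<forall>v\<in>S. pos u < pos v \<longrightarrow> h u = h v \<longrightarrow> v < u)"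
  proof (rule grid_levels)
    show "bij_betw (\<lambda>v. (f v, g v)) S ({..<K} \<times> {..<L})" using bij by (simp add: S_def)
    show "u < v" if "u \<in> S" "v \<in> S" "pos u < pos v" "f u = f v" for u v
      using f that unfolding inc_col_def sorted S_def by auto
    show "v < u" if "u \<in> S" "v \<in> S" "pos u < pos v" "g u = g v" for u v
      using g that unfolding inc_col_def sorted_wrt_rev sorted S_def by auto
  qed
  then obtain h where h: "bij_betw (\<lambda>v. (f v, h v)) S ({..<K} \<times> {..<L})"
    "\<And>u v. u \<in> S \<Longrightarrow> v \<in> S \<Longrightarrow> pos u < pos v \<Longrightarrow> h u = h v \<Longrightarrow> v < u"
    by blast
  \<comment> \<open>The letters whose grid cell lies in the diagram of \<open>\<mu>\<close>; chains
    with index at least \<open>length \<mu>\<close> drop out because \<open>part\<close> is 0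
    there.\<close>
  define \<sigma> where "\<sigma> = filter (\<lambda>v. v \<in> S \<and> h v < part \<mu> (f v)) w"
  have d: "distinct \<sigma>" using w by (simp add: \<sigma>_def)
  have set_\<sigma>: "set \<sigma> = {v \<in> S. h v < part \<mu> (f v)}" by (auto simp: \<sigma>_def S_def)
  have \<mu>L: "part \<mu> i \<le> L" for i
    using part_antimono[OF \<mu>(1), of 0 i] KL \<mu>(3) by (cases \<mu>) auto
  \<comment> \<open>The kept letters biject with the cells of \<open>\<mu>\<close>. The predicate
    \<open>Q\<close> selects all cells, the first \<open>r\<close> rows or the first
    \<open>l\<close> columns.\<close>
  have count: "card {v \<in> set \<sigma>. Q (f v) (h v)} = (\<Sum>i<length \<mu>. card {j. j < \<mu> ! i \<and> Q i j})"
    for Q :: "nat \<Rightarrow> nat \<Rightarrow> bool"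
  proof -
    let ?D = "Sigma {..<length \<mu>} (\<lambda>i. {j. j < \<mu> ! i \<and> Q i j})"
    have "bij_betw (\<lambda>v. (f v, h v)) {v \<in> set \<sigma>. Q (f v) (h v)} ?D"
      unfolding bij_betw_def
    proof
      show "inj_on (\<lambda>v. (f v, h v)) {v \<in> set \<sigma>. Q (f v) (h v)}"
        using h(1) by (auto simp: bij_betw_def set_\<sigma> intro: inj_on_subset)
      have "\<exists>v\<in>S. f v = i \<and> h v = j" if "i < length \<mu>" "j < \<mu> ! i" for i j
      proof -
        have "j < L" using \<mu>L[of i] that by (simp add: part_def)
        then have "(i, j) \<in> (\<lambda>v. (f v, h v)) ` S" using h(1) that KL by (simp add: bij_betw_def)
        then show ?thesis by auto
      qed
      then show "(\<lambda>v. (f v, h v)) ` {v \<in> set \<sigma>. Q (f v) (h v)} = ?D"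
        by (fastforce simp: set_\<sigma> part_def image_iff split: if_splits)
    qed
    then show ?thesis by (simp add: bij_betw_same_card)
  qed
  have sum: "(\<Sum>i<length \<mu>. F (\<mu> ! i)) = sum_list (map F \<mu>)" for F :: "nat \<Rightarrow> nat"
    by (simp add: sum_list_sum_nth atLeast0LessThan)
  have "\<mu> = shape \<sigma>"
  proof (rule partition_eq_dominance)
    have "length \<sigma> = card {v \<in> set \<sigma>. True}" using d by (simp add: distinct_card)
    also have "\<dots> = sum_list \<mu>" using count[of "\<lambda>_ _. True"] sum[of id] by simp
    finally show "sum_list \<mu> = sum_list (shape \<sigma>)" using sum_list_shape[OF d] by simp
    show "\<forall>i\<in>set (shape \<sigma>). 0 < i" by (rule shape_positive[OF d])
  next
    fix r
    have "sorted_wrt (\<lambda>u v. f u = f v \<longrightarrow> f u < K \<longrightarrow> u < v) \<sigma>"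
      using f unfolding inc_col_def \<sigma>_def by (rule sorted_wrt_filter)
    \<comment> \<open>This holds also for \<open>r\<close> above \<open>K\<close>, since every kept
      letter has a colour below \<open>K\<close>.\<close>
    then have "inc_col r f \<sigma>"
      unfolding inc_col_def by (rule sorted_wrt_mono_rel[rotated]) (auto simp: set_\<sigma> S_def)
    then have "covered r f \<sigma> \<le> sum_list (take r (shape \<sigma>))" by (rule greene_increasing_bound[OF d])
    moreover have "covered r f \<sigma> = (\<Sum>i<length \<mu>. card {j. j < \<mu> ! i \<and> i < r})"
      using count[of "\<lambda>i j. i < r"] d by (simp add: covered_eq_card)
    moreover have "\<dots> = (\<Sum>i<length \<mu>. if i < r then \<mu> ! i else 0)"
      by (intro sum.cong) auto
    moreover have "\<dots> = (\<Sum>i<min (length \<mu>) r. \<mu> ! i)"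
      by (intro sum.mono_neutral_cong_right) auto
    moreover have "\<dots> = sum_list (take r \<mu>)"
      by (simp add: sum_list_sum_nth atLeast0LessThan)
    ultimately show "sum_list (take r \<mu>) \<le> sum_list (take r (shape \<sigma>))" by simp
  next
    fix l
    \<comment> \<open>The levels are known to be decreasing only within \<open>S\<close>, hence the
      guards; they become void on \<open>\<sigma>\<close>.\<close>
    have "sorted_wrt (\<lambda>u v. u \<in> S \<longrightarrow> v \<in> S \<longrightarrow> h u = h v \<longrightarrow> v < u) w"
      unfolding sorted using h(2) by blast
    then have "sorted_wrt (\<lambda>u v. u \<in> S \<longrightarrow> v \<in> S \<longrightarrow> h u = h v \<longrightarrow> v < u) \<sigma>"
      unfolding \<sigma>_def by (rule sorted_wrt_filter)
    then have "inc_col l h (rev \<sigma>)"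
      unfolding inc_col_def sorted_wrt_rev by (rule sorted_wrt_mono_rel[rotated]) (auto simp: set_\<sigma>)
    then have "covered l h \<sigma> \<le> sum_list (map (min l) (shape \<sigma>))"
      by (rule greene_decreasing_bound[OF d])
    moreover have "covered l h \<sigma> = (\<Sum>i<length \<mu>. card {j. j < \<mu> ! i \<and> j < l})"
      using count[of "\<lambda>i j. j < l"] d by (simp add: covered_eq_card)
    moreover have "{j. j < n \<and> j < l} = {..<min l n}" for n by auto
    ultimately show "sum_list (map (min l) \<mu>) \<le> sum_list (map (min l) (shape \<sigma>))"
      using sum[of "min l"] by simp
  qed (use \<mu> in auto)
  moreover have "subseq \<sigma> w" unfolding \<sigma>_def by (rule subseq_filter_left)
  ultimately have "subseq \<sigma> w \<and> shape \<sigma> = \<mu>" by simp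
  then show ?thesis by (rule exI)
qed

theorem theorem2:
  fixes n m k :: nat and \<pi> :: "nat \<Rightarrow> nat" and \<mu> :: "nat list"
  assumes "\<pi> permutes {1..n}"
    and "partition_of \<mu> m"
    and "length \<mu> = k"
    and "diagram_le (replicate k (hd \<mu>)) (shape (one_line n \<pi>))"
  shows "\<exists>\<sigma>. subseq \<sigma> (one_line n \<pi>) \<and> shape \<sigma> = \<mu>"
proof (cases "\<mu> = []")
  case True
  \<comment> \<open>Treated separately because \<open>hd []\<close> is unspecified.\<close>
  then show ?thesis by (intro exI[of _ "[]"]) (simp add: shape_eq)
next
  case False
  have "inj \<pi>" using assms(1) by (rule permutes_inj)
  then have "distinct (one_line n \<pi>)"
    unfolding one_line_def by (simp add: distinct_map inj_on_def)
  \<comment> \<open>The last row of the rectangle, with index \<open>k - 1\<close>, is the binding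
    one, since the parts of the shape decrease.\<close>
  moreover have "hd \<mu> \<le> part (shape (one_line n \<pi>)) (length \<mu> - 1)"
  proof -
    have "0 < k" using False assms(3) by auto
    then have "part (replicate k (hd \<mu>)) (length \<mu> - 1) = hd \<mu>"
      using assms(3) by (simp add: part_def)
    then show ?thesis using assms(4) unfolding diagram_le_def by metis
  qed
  ultimately show ?thesis
    using assms(2) False by (intro subseq_with_shape) (auto simp: partition_of_def)
qed

end
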